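(* Let $A=\begin{pmatrix}a&b\\c&d\end{pmatrix}\in\mathcal{M}_2(\mathbb{C})$ and let $B\in\mathcal{M}_m(\mathbb{C})$ be a circulant matrix with first row $(b_0,b_1,\ldots,b_{m-1})$, $b_i\in\mathbb{C}$. Let $\rho=\exp\left(\frac{2\pi i}{m}\right)$ (where in this exponent $i=\sqrt{-1}$). Then the spectrum of $A\wr B$ is $$\bigcup_{i_1,i_2=0,1,\ldots,m-1}\Sigma_{i_1,i_2},$$ where $$\Sigma_{i_1,i_2}=\left\{\frac{\sum_{i=0}^{m-1}b_i(\rho^{i\,i_1}+\rho^{i\,i_2})+a+d}{2}\pm\frac12\sqrt{\left(\sum_{i=1}^{m-1}b_i(\rho^{i\,i_1}-\rho^{i\,i_2})+a-d\right)^2+4bc}\right\}.$$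
   Context: $m$ is a positive integer. Wreath product of matrices: for $A\in\mathcal{M}_n(\mathbb{C})$ and $B\in\mathcal{M}_m(\mathbb{C})$, $$A\wr B = I_m^{\otimes n}\otimes A+\sum_{i=1}^n I_m^{\otimes (i-1)}\otimes B\otimes I_m^{\otimes (n-i)}\otimes C_i,$$ a square matrix of order $nm^n$ (here $n=2$). Here $\otimes$ is the Kronecker product, $I_m^{\otimes r}$ is the $r$-fold Kronecker power, with $I_m^{\otimes 0}=1$, and $C_i\in\mathcal{M}_n(\mathbb{C})$ has entry $1$ in position $(i,i)$ and $0$ elsewhere. A circulant matrix with first row $(b_0,\ldots,b_{m-1})$ is the matrix whose $(h,k)$ entry is $b_{(k-h)\bmod m}$. The symbol $\pm\sqrt{z}$ for complex $z$ denotes the two complex square roots of $z$. Spectra are multisets of eigenvalues counted with algebraic multiplicity, and unions add multiplicities. *)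

theory Defs
  imports Complex_Main "Jordan_Normal_Form.Char_Poly"
begin

definition kronecker_mat :: "'a :: semiring_1 mat \<Rightarrow> 'a mat \<Rightarrow> 'a mat" (infixl "\<otimes>\<^sub>K" 70) where
  "M \<otimes>\<^sub>K N = mat (dim_row M * dim_row N) (dim_col M * dim_col N)
     (\<lambda>(i, j). M $$ (i div dim_row N, j div dim_col N) * N $$ (i mod dim_row N, j mod dim_col N))"

primrec kronecker_power :: "'a :: semiring_1 mat \<Rightarrow> nat \<Rightarrow> 'a mat" where
  "kronecker_power M 0 = 1\<^sub>m 1"
| "kronecker_power M (Suc r) = kronecker_power M r \<otimes>\<^sub>K M"

text \<open>The matrix \<open>C\<^sub>i\<close> for \<open>1 \<le> i \<le> n\<close>. The index \<open>i\<close> counts from 1, while matrix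
  positions count from 0.\<close>

definition diag_unit_mat :: "nat \<Rightarrow> nat \<Rightarrow> 'a :: semiring_1 mat" where
  "diag_unit_mat n i = mat n n (\<lambda>(h, k). if h = i - 1 \<and> k = i - 1 then 1 else 0)"

text \<open>The sum over \<open>i\<close> is a fold, because matrix addition on carriers of varying dimension
  has no neutral element and hence no library big operator at this type.\<close>

definition wreath_mat :: "'a :: semiring_1 mat \<Rightarrow> 'a mat \<Rightarrow> 'a mat" (infixl "\<wr>" 70) where
  "A \<wr> B = (let n = dim_row A; m = dim_row B in
     foldl (+) (kronecker_power (1\<^sub>m m) n \<otimes>\<^sub>K A)
       (map (\<lambda>i. kronecker_power (1\<^sub>m m) (i - 1) \<otimes>\<^sub>K B \<otimes>\<^sub>K kronecker_power (1\<^sub>m m) (n - i)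
                   \<otimes>\<^sub>K diag_unit_mat n i)
         [1..<Suc n]))"

definition circulant_mat :: "nat \<Rightarrow> (nat \<Rightarrow> 'a) \<Rightarrow> 'a mat" where
  "circulant_mat m v = mat m m (\<lambda>(h, k). v (nat ((int k - int h) mod int m)))"

text \<open>Eigenvalues with algebraic multiplicity.\<close>

definition spectrum_mset :: "'a :: idom mat \<Rightarrow> 'a multiset" where
  "spectrum_mset M = proots (char_poly M)"

end

theory Submission
  imports Defs
begin

text \<open>
  The discrete Fourier matrix \<open>F\<close> diagonalises the circulant matrix: \<open>B = F D F\<^sup>-\<^sup>1\<close>. By the mixed
  product rule for Kronecker products, conjugating \<open>A \<wr> B\<close> by \<open>F \<otimes> F \<otimes> I\<^sub>2\<close> yields \<open>A \<wr> D\<close>, which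
  is block diagonal: its \<open>m\<^sup>2\<close> blocks are \<open>A + diag (\<lambda>\<^sub>i, \<lambda>\<^sub>j)\<close>, where \<open>\<lambda>\<^sub>i, \<lambda>\<^sub>j\<close> range over the
  eigenvalues of \<open>B\<close>. The quadratic formula gives the spectrum of each block.
\<close>

section \<open>Kronecker products\<close>

text \<open>Division with remainder by \<open>k\<close> makes one index a pair. This serves the
  inner sum of a Kronecker product and, at the end, the passage from blocks to pairs of
  eigenvalues.\<close>

lemma sum_lessThan_mult_eq:
  fixes f :: "nat \<Rightarrow> 'a :: comm_monoid_add"
  shows "sum f {..<n * k} = (\<Sum>i<n. \<Sum>j<k. f (i * k + j))"
proof -
  have "sum f {i * k..<i * k + k} = (\<Sum>j<k. f (i * k + j))" for i
    using sum.shift_bounds_nat_ivl[of f 0 "i * k" k] by (simp add: lessThan_atLeast0 add.commute)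
  then show ?thesis
    by (simp flip: sum.nat_group)
qed

lemma dim_kronecker_mat [simp]:
  "dim_row (M \<otimes>\<^sub>K N) = dim_row M * dim_row N"
  "dim_col (M \<otimes>\<^sub>K N) = dim_col M * dim_col N"
  by (simp_all add: kronecker_mat_def)

lemma index_kronecker_mat [simp]:
  "i < dim_row M * dim_row N \<Longrightarrow> j < dim_col M * dim_col N \<Longrightarrow>
    (M \<otimes>\<^sub>K N) $$ (i, j) =
      M $$ (i div dim_row N, j div dim_col N) * N $$ (i mod dim_row N, j mod dim_col N)"
  by (simp add: kronecker_mat_def)

lemma mod_less_of_less_mult: "i < a * b \<Longrightarrow> i mod b < b" for i a b :: nat
  by (cases "b = 0") auto

text \<open>The inner index is a pair \<open>k * ?q + l\<close>. After commuting the scalars, the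
  summand separates into a factor in \<open>k\<close> and a factor in \<open>l\<close>, so the
  double sum is a product of two entries.\<close>

lemma kronecker_mat_mult:
  fixes M N X Y :: "'a :: comm_semiring_1 mat"
  assumes "dim_col M = dim_row X" and "dim_col N = dim_row Y"
  shows "(M \<otimes>\<^sub>K N) * (X \<otimes>\<^sub>K Y) = (M * X) \<otimes>\<^sub>K (N * Y)" (is "?L = ?R")
proof (rule eq_matI)
  fix i j assume "i < dim_row ?R" "j < dim_col ?R"
  then have i: "i < dim_row M * dim_row N" and j: "j < dim_col X * dim_col Y" by simp_all
  note i' = less_mult_imp_div_less[OF i] mod_less_of_less_mult[OF i]
  note j' = less_mult_imp_div_less[OF j] mod_less_of_less_mult[OF j]
  let ?p = "dim_row X" and ?q = "dim_row Y"
  have idx: "k * ?q + l < ?p * ?q" if "k < ?p" "l < ?q" for k l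
  proof -
    have "k * ?q + l < Suc k * ?q" using that by simp
    also have "\<dots> \<le> ?p * ?q" using that by (intro mult_le_mono1) simp
    finally show ?thesis .
  qed
  have "?L $$ (i, j) = (\<Sum>l<?p * ?q. (M \<otimes>\<^sub>K N) $$ (i, l) * (X \<otimes>\<^sub>K Y) $$ (l, j))"
    using i j assms by (simp add: scalar_prod_def lessThan_atLeast0)
  also have "\<dots> = (\<Sum>k<?p. \<Sum>l<?q. (M \<otimes>\<^sub>K N) $$ (i, k * ?q + l) * (X \<otimes>\<^sub>K Y) $$ (k * ?q + l, j))"
    by (rule sum_lessThan_mult_eq)
  also have "\<dots> = (\<Sum>k<?p. \<Sum>l<?q. (M $$ (i div dim_row N, k) * X $$ (k, j div dim_col Y)) *
      (N $$ (i mod dim_row N, l) * Y $$ (l, j mod dim_col Y)))"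
    using i j assms idx by (intro sum.cong refl) (simp add: ac_simps)
  also have "\<dots> = ?R $$ (i, j)"
    using i j i' j' assms by (simp add: scalar_prod_def lessThan_atLeast0 sum_product)
  finally show "?L $$ (i, j) = ?R $$ (i, j)" .
qed simp_all

lemma kronecker_mat_one_one: "1\<^sub>m m \<otimes>\<^sub>K 1\<^sub>m n = 1\<^sub>m (m * n)"
proof (rule eq_matI)
  fix i j assume "i < dim_row (1\<^sub>m (m * n))" "j < dim_col (1\<^sub>m (m * n))"
  then have i: "i < m * n" and j: "j < m * n" by simp_all
  have "i = j \<longleftrightarrow> i div n = j div n \<and> i mod n = j mod n"
    by (metis div_mult_mod_eq)
  then show "(1\<^sub>m m \<otimes>\<^sub>K 1\<^sub>m n) $$ (i, j) = 1\<^sub>m (m * n) $$ (i, j)"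
    using i j less_mult_imp_div_less[OF i] mod_less_of_less_mult[OF i]
      less_mult_imp_div_less[OF j] mod_less_of_less_mult[OF j]
    by auto
qed simp_all

text \<open>Written with \<open>Suc 0\<close>, the form to which the simplifier brings the dimension
  \<open>1\<close>.\<close>

lemma kronecker_mat_one_left [simp]: "1\<^sub>m (Suc 0) \<otimes>\<^sub>K M = M"
  by (rule eq_matI) auto

lemma kronecker_mat_one_right [simp]: "M \<otimes>\<^sub>K 1\<^sub>m (Suc 0) = M"
  by (rule eq_matI) auto

text \<open>The mixed product rule gives both the conjugation identity and the fact that the two
  outer factors are mutually inverse.\<close>

lemma kronecker_mat_similar:
  fixes M N :: "'a :: comm_semiring_1 mat"
  assumes "similar_mat_wit M M' P Q" and "similar_mat_wit N N' R S"
  shows "similar_mat_wit (M \<otimes>\<^sub>K N) (M' \<otimes>\<^sub>K N') (P \<otimes>\<^sub>K R) (Q \<otimes>\<^sub>K S)"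
proof -
  define m n where "m = dim_row M" and "n = dim_row N"
  note 1 = similar_mat_witD[OF m_def assms(1)] and 2 = similar_mat_witD[OF n_def assms(2)]
  note dims = 1(4-7)[THEN carrier_matD(1)] 1(4-7)[THEN carrier_matD(2)]
    2(4-7)[THEN carrier_matD(1)] 2(4-7)[THEN carrier_matD(2)]
  show ?thesis
  proof (rule similar_mat_witI)
    show "M \<otimes>\<^sub>K N = (P \<otimes>\<^sub>K R) * (M' \<otimes>\<^sub>K N') * (Q \<otimes>\<^sub>K S)"
      by (simp add: kronecker_mat_mult dims flip: 1(3) 2(3))
  qed (auto simp: kronecker_mat_mult kronecker_mat_one_one dims 1(1,2) 2(1,2) intro!: carrier_matI)
qed

text \<open>Similarity alone is not additive; it becomes so when both summands share the same
  conjugating pair. Hence the explicit witnesses.\<close>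

lemma similar_mat_wit_add:
  fixes M N :: "'a :: semiring_1 mat"
  assumes "similar_mat_wit M M' P Q" and "similar_mat_wit N N' P Q"
  shows "similar_mat_wit (M + N) (M' + N') P Q"
proof -
  define n where "n = dim_row M"
  note 1 = similar_mat_witD[OF n_def assms(1)]
  have "dim_row N = n"
    using similar_mat_witD(6)[OF refl assms(2)] 1(6) by auto
  note 2 = similar_mat_witD[OF this[symmetric] assms(2)]
  show ?thesis
  proof (rule similar_mat_witI[OF 1(1,2)])
    have "P * (M' + N') * Q = (P * M' + P * N') * Q"
      using 1 2 by (simp add: mult_add_distrib_mat[of P n n])
    also have "\<dots> = P * M' * Q + P * N' * Q"
      using 1 2 by (intro add_mult_distrib_mat[of _ n n]) auto
    finally show "M + N = P * (M' + N') * Q"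
      using 1(3) 2(3) by simp
  qed (use 1 2 in auto)
qed

section \<open>The wreath product with a matrix of order two\<close>

lemma wreath_mat_2:
  fixes A B :: "'a :: semiring_1 mat"
  assumes "dim_row A = 2" and "dim_row B = m"
  shows "A \<wr> B = 1\<^sub>m m \<otimes>\<^sub>K 1\<^sub>m m \<otimes>\<^sub>K A + B \<otimes>\<^sub>K 1\<^sub>m m \<otimes>\<^sub>K diag_unit_mat 2 1
    + 1\<^sub>m m \<otimes>\<^sub>K B \<otimes>\<^sub>K diag_unit_mat 2 2"
proof -
  have "[1..<Suc 2] = [1, 2]" by (simp add: upt_rec)
  moreover have "kronecker_power (1\<^sub>m m) 1 = (1\<^sub>m m :: 'a mat)"
    "kronecker_power (1\<^sub>m m) 2 = (1\<^sub>m m \<otimes>\<^sub>K 1\<^sub>m m :: 'a mat)"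
    by (simp_all add: numeral_2_eq_2)
  ultimately show ?thesis
    using assms by (simp add: wreath_mat_def Let_def del: upt_Suc)
qed

lemma diag_unit_mat_carrier [simp]: "diag_unit_mat n i \<in> carrier_mat n n"
  by (simp add: diag_unit_mat_def)

text \<open>One pair conjugates all three summands: identity factors are fixed, \<open>B\<close>
  turns into \<open>D\<close>, and the factors of order two meet only
  \<open>1\<^sub>m 2\<close>.\<close>

lemma wreath_mat_2_similar:
  fixes A B :: "'a :: comm_semiring_1 mat"
  assumes A: "A \<in> carrier_mat 2 2" and B: "similar_mat_wit B D P Q"
  shows "similar_mat (A \<wr> B) (A \<wr> D)"
proof -
  define m where "m = dim_row B"
  note B' = similar_mat_witD[OF m_def B]
  \<comment> \<open>The identity is conjugated by \<open>P\<close> and \<open>Q\<close> as well, so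
    that the witnesses of the summands agree.\<close>
  have one: "similar_mat_wit (1\<^sub>m m) (1\<^sub>m m) P Q"
    by (rule similar_mat_witI) (use B' in auto)
  have two: "similar_mat_wit X X (1\<^sub>m 2) (1\<^sub>m 2)" if "X \<in> carrier_mat 2 2" for X :: "'a mat"
    using that by (rule similar_mat_wit_refl)
  have "similar_mat_wit (A \<wr> B) (A \<wr> D) (P \<otimes>\<^sub>K P \<otimes>\<^sub>K 1\<^sub>m 2) (Q \<otimes>\<^sub>K Q \<otimes>\<^sub>K 1\<^sub>m 2)"
    unfolding wreath_mat_2[OF carrier_matD(1)[OF A] carrier_matD(1)[OF B'(4)]]
      wreath_mat_2[OF carrier_matD(1)[OF A] carrier_matD(1)[OF B'(5)]]
    by (intro similar_mat_wit_add kronecker_mat_similar one two B A diag_unit_mat_carrier)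
  then show ?thesis
    by (auto simp: similar_mat_def)
qed

section \<open>Block diagonal matrices\<close>

text \<open>Positions are addressed by quotient and remainder, as in the Kronecker product, which
  permits an entrywise comparison with \<open>\<wr>\<close>.\<close>

definition block_diagonal_mat :: "nat \<Rightarrow> nat \<Rightarrow> (nat \<Rightarrow> 'a :: zero mat) \<Rightarrow> 'a mat" where
  "block_diagonal_mat n k M = mat (n * k) (n * k)
     (\<lambda>(i, j). if i div k = j div k then M (i div k) $$ (i mod k, j mod k) else 0)"

text \<open>Induction on the number of blocks: splitting off the last one leaves a block triangular
  matrix, whose determinant is a product.\<close>

lemma det_block_diagonal_mat:
  fixes M :: "nat \<Rightarrow> 'a :: idom mat"
  assumes "\<And>q. q < n \<Longrightarrow> M q \<in> carrier_mat k k"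
  shows "det (block_diagonal_mat n k M) = (\<Prod>q<n. det (M q))"
  using assms
proof (induction n)
  case 0
  then show ?case by (simp add: block_diagonal_mat_def)
next
  case (Suc n)
  have "block_diagonal_mat (Suc n) k M =
      four_block_mat (block_diagonal_mat n k M) (0\<^sub>m (n * k) k) (0\<^sub>m k (n * k)) (M n)"
    (is "?L = ?R")
  proof (rule eq_matI)
    have dim: "M n \<in> carrier_mat k k" using Suc.prems by simp
    then show "dim_row ?L = dim_row ?R" "dim_col ?L = dim_col ?R"
      by (simp_all add: block_diagonal_mat_def)
    have last: "i div k = n \<and> i mod k = i - n * k" if "i < k + n * k" "\<not> i < n * k" for i
    proof -
      have "i = n * k + (i - n * k)" "i - n * k < k" using that by linarith+
      then obtain t where "i = n * k + t" "t < k" by blast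
      then show ?thesis by auto
    qed
    fix i j assume "i < dim_row ?R" "j < dim_col ?R"
    then have "i < k + n * k" "j < k + n * k"
      using dim by (simp_all add: block_diagonal_mat_def)
    \<comment> \<open>Each index lies either in the first \<open>n\<close> blocks or in the last
      one; the four combinations are then checked separately.\<close>
    moreover from this have
      "i < n * k \<and> i div k \<noteq> n \<or> \<not> i < n * k \<and> i div k = n \<and> i mod k = i - n * k"
      "j < n * k \<and> j div k \<noteq> n \<or> \<not> j < n * k \<and> j div k = n \<and> j mod k = j - n * k"
      using last less_mult_imp_div_less by blast+
    ultimately show "?L $$ (i, j) = ?R $$ (i, j)"
      using carrier_matD[OF dim] by (elim disjE conjE) (simp_all add: block_diagonal_mat_def)
  qed
  also have "det \<dots> = det (block_diagonal_mat n k M) * det (M n)"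
    using Suc.prems by (intro det_four_block_mat_lower_left_zero[of _ "n * k" _ k])
      (simp_all add: block_diagonal_mat_def)
  also have "\<dots> = (\<Prod>q<Suc n. det (M q))"
    using Suc by simp
  finally show ?case .
qed

text \<open>The characteristic matrix is again block diagonal, because equal indices lie in the same
  block at the same inner position.\<close>

lemma char_poly_block_diagonal_mat:
  fixes M :: "nat \<Rightarrow> 'a :: idom mat"
  assumes M: "\<And>q. q < n \<Longrightarrow> M q \<in> carrier_mat k k"
  shows "char_poly (block_diagonal_mat n k M) = (\<Prod>q<n. char_poly (M q))"
proof -
  have "char_poly_matrix (block_diagonal_mat n k M) =
      block_diagonal_mat n k (\<lambda>q. char_poly_matrix (M q))" (is "?L = ?R")
  proof (rule eq_matI)
    fix i j assume "i < dim_row ?R" "j < dim_col ?R"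
    then have i: "i < n * k" and j: "j < n * k" by (simp_all add: block_diagonal_mat_def)
    have "i = j \<longleftrightarrow> i div k = j div k \<and> i mod k = j mod k"
      by (metis div_mult_mod_eq)
    then show "?L $$ (i, j) = ?R $$ (i, j)"
      using i j less_mult_imp_div_less[OF i] mod_less_of_less_mult[OF i]
        less_mult_imp_div_less[OF j] mod_less_of_less_mult[OF j] M[of "i div k"]
      by (auto simp: block_diagonal_mat_def char_poly_matrix_def)
  qed (simp_all add: block_diagonal_mat_def char_poly_matrix_def)
  then show ?thesis
    using M by (simp add: char_poly_def det_block_diagonal_mat)
qed

text \<open>Characteristic polynomials are monic. Nonvanishing is what allows the roots of a product
  to be split among its factors.\<close>

lemma char_poly_ne_0: "char_poly M \<noteq> 0" if "M \<in> carrier_mat n n" for M :: "'a :: idom mat"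
proof
  assume "char_poly M = 0"
  with degree_monic_char_poly[OF that] show False by simp
qed

text \<open>For diagonal \<open>D\<close>, all three summands vanish off the blocks. In block
  \<open>q\<close>, \<open>C_1\<close> places the eigenvalue of the first tensor factor,
  \<open>l (q div m)\<close>, at the first diagonal position, and \<open>C_2\<close> places
  \<open>l (q mod m)\<close> at the second.\<close>

lemma wreath_mat_2_diagonal:
  fixes l :: "nat \<Rightarrow> 'a :: comm_semiring_1"
  assumes A: "A \<in> carrier_mat 2 2"
  shows "A \<wr> mat m m (\<lambda>(i, j). if i = j then l i else 0) =
    block_diagonal_mat (m * m) 2 (\<lambda>q. mat 2 2 (\<lambda>(e, f). A $$ (e, f) +
      (if e = f then if e = 0 then l (q div m) else l (q mod m) else 0)))"
    (is "?L = ?R")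
proof -
  define D where "D = mat m m (\<lambda>(i, j). if i = j then l i else 0)"
  have D: "dim_row D = m" "dim_col D = m" by (simp_all add: D_def)
  have dA: "dim_row A = 2" "dim_col A = 2" using A by auto
  show ?thesis
    unfolding D_def[symmetric] wreath_mat_2[OF dA(1) D(1)]
  proof (rule eq_matI, goal_cases)
    case (1 i j)
    then have i: "i < m * m * 2" and j: "j < m * m * 2"
      by (simp_all add: block_diagonal_mat_def)
    \<comment> \<open>A row index carries three digits: \<open>p div m\<close> and
      \<open>p mod m\<close> for the tensor factors, and \<open>e\<close> inside the block. Columns
      use \<open>q\<close> and \<open>f\<close> alike.\<close>
    define p q e f where "p = i div 2" and "q = j div 2" and "e = i mod 2" and "f = j mod 2"
    have p: "p < m * m" and q: "q < m * m" and e: "e < 2" and f: "f < 2"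
      using i j by (auto simp: p_def q_def e_def f_def)
    note pq = less_mult_imp_div_less[OF p] mod_less_of_less_mult[OF p]
      less_mult_imp_div_less[OF q] mod_less_of_less_mult[OF q]
    have eq: "p = q \<longleftrightarrow> p div m = q div m \<and> p mod m = q mod m"
      by (metis div_mult_mod_eq)
    have outer: "(X \<otimes>\<^sub>K Y \<otimes>\<^sub>K Z) $$ (i, j) =
        X $$ (p div m, q div m) * Y $$ (p mod m, q mod m) * Z $$ (e, f)"
      if "X \<in> carrier_mat m m" "Y \<in> carrier_mat m m" "Z \<in> carrier_mat 2 2" for X Y Z :: "'a mat"
      using that[THEN carrier_matD(1)] that[THEN carrier_matD(2)] i j p q
      by (simp add: p_def q_def e_def f_def)
    have A_term: "(1\<^sub>m m \<otimes>\<^sub>K 1\<^sub>m m \<otimes>\<^sub>K A) $$ (i, j) = (if p = q then A $$ (e, f) else 0)"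
      using A by (simp add: outer pq eq)
    have fst_term: "(D \<otimes>\<^sub>K 1\<^sub>m m \<otimes>\<^sub>K diag_unit_mat 2 1) $$ (i, j) =
        (if p = q then if e = 0 \<and> f = 0 then l (p div m) else 0 else 0)"
      using e f by (subst outer) (simp_all add: D_def diag_unit_mat_def pq eq)
    have snd_term: "(1\<^sub>m m \<otimes>\<^sub>K D \<otimes>\<^sub>K diag_unit_mat 2 2) $$ (i, j) =
        (if p = q then if e = 1 \<and> f = 1 then l (p mod m) else 0 else 0)"
      using e f by (subst outer) (simp_all add: D_def diag_unit_mat_def pq eq)
    have "?R $$ (i, j) = (if p = q then A $$ (e, f) +
        (if e = f then if e = 0 then l (p div m) else l (p mod m) else 0) else 0)"
      using i j e f unfolding p_def q_def e_def f_def by (simp add: block_diagonal_mat_def)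
    also have "\<dots> = (1\<^sub>m m \<otimes>\<^sub>K 1\<^sub>m m \<otimes>\<^sub>K A) $$ (i, j) + (D \<otimes>\<^sub>K 1\<^sub>m m \<otimes>\<^sub>K diag_unit_mat 2 1) $$ (i, j)
        + (1\<^sub>m m \<otimes>\<^sub>K D \<otimes>\<^sub>K diag_unit_mat 2 2) $$ (i, j)"
      unfolding A_term fst_term snd_term using less_2_cases[OF e] less_2_cases[OF f]
      by (elim disjE) simp_all
    finally show ?case
      using i j D dA by (simp add: diag_unit_mat_def del: index_kronecker_mat)
  qed (simp_all add: D dA block_diagonal_mat_def diag_unit_mat_def)
qed

section \<open>Diagonalisation of circulant matrices\<close>

lemma root_of_unity_power_mod:
  fixes \<rho> :: "'a :: monoid_mult"
  assumes "\<rho> ^ m = 1"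
  shows "\<rho> ^ (k mod m) = \<rho> ^ k"
proof -
  have "\<rho> ^ k = \<rho> ^ (m * (k div m) + k mod m)" by simp
  also have "\<dots> = \<rho> ^ (k mod m)" unfolding power_add power_mult assms by simp
  finally show ?thesis by simp
qed

text \<open>The columns of the Fourier matrix are eigenvectors: a cyclic shift multiplies such a
  column by a power of \<open>\<rho>\<close>. Unity and injectivity together say that
  \<open>\<rho>\<close> is a primitive root.\<close>

lemma circulant_mat_similar_diagonal:
  fixes \<rho> :: "'a :: field_char_0"
  assumes m: "m > 0" and unity: "\<rho> ^ m = 1" and inj: "inj_on (\<lambda>k. \<rho> ^ k) {..<m}"
  shows "\<exists>P Q. similar_mat_wit (circulant_mat m v)
    (mat m m (\<lambda>(i, j). if i = j then \<Sum>k<m. v k * \<rho> ^ (k * i) else 0)) P Q"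
proof -
  define F where "F = mat m m (\<lambda>(h, k). \<rho> ^ (h * k))"
  \<comment> \<open>Inverses of powers replace complex conjugates, so the argument runs in any field
    of characteristic zero.\<close>
  define G where "G = mat m m (\<lambda>(h, k). inverse (\<rho> ^ (h * k)) / of_nat m)"
  define B where "B = circulant_mat m v"
  define l where "l i = (\<Sum>k<m. v k * \<rho> ^ (k * i))" for i
  define D where "D = mat m m (\<lambda>(i, j). if i = j then l i else 0)"
  have nz: "\<rho> \<noteq> 0" using unity m by (auto simp: power_0_left)
  have carrier: "F \<in> carrier_mat m m" "G \<in> carrier_mat m m" "B \<in> carrier_mat m m"
      "D \<in> carrier_mat m m"
    by (simp_all add: F_def G_def B_def D_def circulant_mat_def)
  have power_unity: "(\<rho> ^ i) ^ m = 1" for i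
    by (metis unity power_mult mult.commute power_one)
  have FG: "F * G = 1\<^sub>m m"
  proof (rule eq_matI)
    fix h k assume "h < dim_row (1\<^sub>m m)" "k < dim_col (1\<^sub>m m)"
    then have h: "h < m" and k: "k < m" by simp_all
    \<comment> \<open>Orthogonality of characters: \<open>z\<close> is an \<open>m\<close>-th root
      of unity, equal to 1 exactly when \<open>h = k\<close>, so its geometric sum is
      \<open>m\<close> or 0.\<close>
    define z where "z = \<rho> ^ h / \<rho> ^ k"
    have zm: "z ^ m = 1"
      unfolding z_def power_divide power_unity by simp
    have z1: "z = 1 \<longleftrightarrow> h = k"
      using inj_onD[OF inj, of h k] h k nz by (auto simp: z_def)
    have "\<rho> ^ (h * j) * (inverse (\<rho> ^ (j * k)) / of_nat m) = z ^ j / of_nat m" for j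
      unfolding z_def power_divide mult.commute[of j] power_mult by (simp add: inverse_eq_divide)
    then have "(F * G) $$ (h, k) = (\<Sum>j<m. z ^ j / of_nat m)"
      using h k by (simp add: F_def G_def scalar_prod_def lessThan_atLeast0)
    also have "\<dots> = (\<Sum>j<m. z ^ j) / of_nat m"
      by (simp add: sum_divide_distrib)
    also have "\<dots> = (if h = k then 1 else 0)"
      using m zm z1 by (auto simp: geometric_sum)
    finally show "(F * G) $$ (h, k) = 1\<^sub>m m $$ (h, k)"
      using h k by simp
  qed (simp_all add: F_def G_def)
  have BF: "B * F = F * D"
  proof (rule eq_matI)
    fix h k assume "h < dim_row (F * D)" "k < dim_col (F * D)"
    then have h: "h < m" and k: "k < m" by (simp_all add: F_def D_def)
    have "(B * F) $$ (h, k) = (\<Sum>j<m. v (nat ((int j - int h) mod int m)) * \<rho> ^ (j * k))"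
      using h k by (simp add: B_def circulant_mat_def F_def scalar_prod_def lessThan_atLeast0)
    \<comment> \<open>Substitutes \<open>i = (j - h) mod m\<close>, with inverse
      \<open>j = (i + h) mod m\<close>. The exponent may drop the reduction since
      \<open>\<rho> ^ m = 1\<close>.\<close>
    also have "\<dots> = (\<Sum>i<m. v i * \<rho> ^ ((i + h) * k))"
    proof (rule sum.reindex_bij_witness[where j = "\<lambda>j. nat ((int j - int h) mod int m)"
          and i = "\<lambda>i. (i + h) mod m"])
      fix j assume j: "j \<in> {..<m}"
      let ?i = "nat ((int j - int h) mod int m)"
      have "int ((?i + h) mod m) = int j"
        using j m by (simp add: zmod_int mod_add_left_eq)
      then show inv: "(?i + h) mod m = j" by simp
      show "?i \<in> {..<m}" using m by (simp add: nat_less_iff)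
      have "\<rho> ^ (j * k) = (\<rho> ^ ((?i + h) mod m)) ^ k"
        by (simp only: inv power_mult)
      then show "v ?i * \<rho> ^ ((?i + h) * k) = v ?i * \<rho> ^ (j * k)"
        by (simp add: root_of_unity_power_mod[OF unity] power_mult)
    next
      fix i assume i: "i \<in> {..<m}"
      show "(i + h) mod m \<in> {..<m}" using m by simp
      have "(int ((i + h) mod m) - int h) mod int m = int i"
        using i by (simp add: zmod_int mod_diff_left_eq)
      then show "nat ((int ((i + h) mod m) - int h) mod int m) = i" by simp
    qed
    also have "\<dots> = \<rho> ^ (h * k) * l k"
      by (simp add: l_def sum_distrib_left power_add algebra_simps)
    also have "\<dots> = (F * D) $$ (h, k)"
      using h k by (simp add: F_def D_def scalar_prod_def if_distrib[of "(*) _"] cong: if_cong)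
    finally show "(B * F) $$ (h, k) = (F * D) $$ (h, k)" .
  qed (simp_all add: B_def F_def D_def circulant_mat_def)
  have "B = B * (F * G)"
    using carrier by (simp add: FG)
  also have "\<dots> = F * D * G"
    using carrier BF assoc_mult_mat[of B m m F m G m] by simp
  finally have "similar_mat_wit B D F G"
    using carrier FG mat_mult_left_right_inverse[OF carrier(1,2) FG] by (intro similar_mat_witI)
  then show ?thesis
    unfolding B_def D_def l_def by blast
qed

text \<open>By De Moivre, the powers of \<open>\<rho>\<close> are the standard bijective enumeration
  of the \<open>m\<close>-th roots of unity.\<close>

lemma primitive_root_of_unity_exp:
  assumes "m > 0"
  defines "\<rho> \<equiv> exp (2 * complex_of_real pi * \<i> / of_nat m)"
  shows "\<rho> ^ m = 1" and "inj_on (\<lambda>k. \<rho> ^ k) {..<m}"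
proof -
  have "\<rho> = cis (2 * pi / real m)"
    by (simp add: \<rho>_def cis_conv_exp mult_ac)
  then have "(\<lambda>k. \<rho> ^ k) = (\<lambda>k. cis (2 * pi * real k / real m))"
    by (simp add: DeMoivre mult_ac)
  then show "inj_on (\<lambda>k. \<rho> ^ k) {..<m}"
    using bij_betw_roots_unity[OF assms(1)] by (simp add: bij_betw_def)
  show "\<rho> ^ m = 1"
    using assms(1) \<open>\<rho> = _\<close> by (simp add: DeMoivre)
qed

section \<open>Matrices of order two\<close>

text \<open>Obtained from the block determinant formula with blocks of order one, which
  commute.\<close>

lemma det_2_by_2:
  fixes M :: "'a :: idom mat"
  assumes M: "M \<in> carrier_mat 2 2"
  shows "det M = M $$ (0, 0) * M $$ (1, 1) - M $$ (0, 1) * M $$ (1, 0)"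
proof -
  let ?s = "\<lambda>x. mat 1 1 (\<lambda>_. x)"
  have "M = four_block_mat (?s (M $$ (0, 0))) (?s (M $$ (0, 1))) (?s (M $$ (1, 0))) (?s (M $$ (1, 1)))"
    (is "_ = ?B") using M by (intro eq_matI) (auto simp: less_Suc_eq)
  then have "det M = det ?B"
    by (rule arg_cong)
  also have "det ?B = det (?s (M $$ (0, 0)) * ?s (M $$ (1, 1)) - ?s (M $$ (0, 1)) * ?s (M $$ (1, 0)))"
    by (rule det_four_block_mat) (auto simp: scalar_prod_def mult.commute intro!: eq_matI)
  also have "\<dots> = (?s (M $$ (0, 0)) * ?s (M $$ (1, 1)) - ?s (M $$ (0, 1)) * ?s (M $$ (1, 0))) $$ (0, 0)"
    by (intro det_single minus_carrier_mat mult_carrier_mat[of _ 1 1]) simp_all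
  also have "\<dots> = M $$ (0, 0) * M $$ (1, 1) - M $$ (0, 1) * M $$ (1, 0)"
    by (simp add: scalar_prod_def)
  finally show ?thesis .
qed

text \<open>Here \<open>s\<close> is half the trace and \<open>r\<close> any square root of the
  discriminant; the choice is immaterial because both signs occur. If \<open>r = 0\<close>, the
  multiset records a double eigenvalue.\<close>

lemma spectrum_mset_2_by_2:
  fixes M :: "complex mat"
  assumes M: "M \<in> carrier_mat 2 2"
    and s: "s = (M $$ (0, 0) + M $$ (1, 1)) / 2"
    and r: "r\<^sup>2 = (M $$ (0, 0) - M $$ (1, 1))\<^sup>2 + 4 * (M $$ (0, 1) * M $$ (1, 0))"
  shows "spectrum_mset M = {# s + 1 / 2 * r, s - 1 / 2 * r #}"
proof -
  have "char_poly M = [:- M $$ (0, 0), 1:] * [:- M $$ (1, 1), 1:]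
      - [:- M $$ (0, 1):] * [:- M $$ (1, 0):]"
    unfolding char_poly_def
    by (subst det_2_by_2) (use M in \<open>auto simp: char_poly_matrix_def\<close>)
  also have "\<dots> = [:M $$ (0, 0) * M $$ (1, 1) - M $$ (0, 1) * M $$ (1, 0),
      - (M $$ (0, 0) + M $$ (1, 1)), 1:]"
    by simp
  also have "M $$ (0, 0) + M $$ (1, 1) = (s + 1 / 2 * r) + (s - 1 / 2 * r)"
    by (simp add: s)
  \<comment> \<open>Four times the determinant is the squared trace minus the discriminant.\<close>
  also have "M $$ (0, 0) * M $$ (1, 1) - M $$ (0, 1) * M $$ (1, 0) = s\<^sup>2 - r\<^sup>2 / 4"
    unfolding r s by (simp add: field_simps power2_eq_square)
  also have "\<dots> = (s + 1 / 2 * r) * (s - 1 / 2 * r)"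
    by (simp add: algebra_simps power2_eq_square)
  also have "[:(s + 1 / 2 * r) * (s - 1 / 2 * r), - ((s + 1 / 2 * r) + (s - 1 / 2 * r)), 1:] =
      [:- (s + 1 / 2 * r), 1:] * [:- (s - 1 / 2 * r), 1:]"
    by (simp add: algebra_simps)
  \<comment> \<open>Expansion of polynomial products is disabled so that \<open>proots_mult\<close>
    sees the two linear factors.\<close>
  finally show ?thesis
    by (simp add: spectrum_mset_def proots_mult add_mset_commute del: mult_pCons_left mult_pCons_right)
qed

section \<open>Spectrum of the wreath product\<close>

theorem corollary5p2:
  fixes m :: nat and a b c d \<rho> :: complex and v :: "nat \<Rightarrow> complex" and A B :: "complex mat"
  assumes "m > 0"
    and "A = mat_of_rows_list 2 [[a, b], [c, d]]"
    and "B = circulant_mat m v"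
    and "\<rho> = exp (2 * complex_of_real pi * \<i> / of_nat m)"
  shows "spectrum_mset (A \<wr> B) =
    (\<Sum>i\<^sub>1 = 0..m - 1. \<Sum>i\<^sub>2 = 0..m - 1.
      (let s = ((\<Sum>i = 0..m - 1. v i * (\<rho> ^ (i * i\<^sub>1) + \<rho> ^ (i * i\<^sub>2))) + a + d) / 2;
           r = csqrt (((\<Sum>i = 1..m - 1. v i * (\<rho> ^ (i * i\<^sub>1) - \<rho> ^ (i * i\<^sub>2))) + a - d)\<^sup>2
                 + 4 * b * c)
       in {# s + 1 / 2 * r, s - 1 / 2 * r #}))"
proof -
  have A: "A \<in> carrier_mat 2 2"
    unfolding assms(2) by (auto simp: mat_of_rows_list_def)
  have entries: "A $$ (0, 0) = a" "A $$ (0, 1) = b" "A $$ (1, 0) = c" "A $$ (1, 1) = d"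
    using assms(2) by (simp_all add: mat_of_rows_list_def)
  define l where "l i = (\<Sum>k<m. v k * \<rho> ^ (k * i))" for i
  define M where "M q = mat 2 2 (\<lambda>(e, f). A $$ (e, f) +
      (if e = f then if e = 0 then l (q div m) else l (q mod m) else 0))" for q
  have M: "M q \<in> carrier_mat 2 2" for q by (simp add: M_def)
  \<comment> \<open>Positivity of \<open>m\<close> matters: for \<open>m = 0\<close>, truncated
    subtraction would make the left side \<open>{0}\<close>.\<close>
  have upto: "{0..m - 1} = {..<m}" using assms(1) by auto
  have "\<rho> ^ m = 1" "inj_on (\<lambda>k. \<rho> ^ k) {..<m}"
    unfolding assms(4) by (rule primitive_root_of_unity_exp[OF assms(1)])+
  then obtain P Q where "similar_mat_wit B (mat m m (\<lambda>(i, j). if i = j then l i else 0)) P Q"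
    unfolding assms(3) l_def using circulant_mat_similar_diagonal[OF assms(1)] by blast
  then have "similar_mat (A \<wr> B) (block_diagonal_mat (m * m) 2 M)"
    using wreath_mat_2_similar[OF A] wreath_mat_2_diagonal[OF A, of m l]
    unfolding M_def by metis
  then have "char_poly (A \<wr> B) = (\<Prod>q<m * m. char_poly (M q))"
    using M by (simp add: char_poly_similar char_poly_block_diagonal_mat)
  then have "spectrum_mset (A \<wr> B) = (\<Sum>q<m * m. spectrum_mset (M q))"
    unfolding spectrum_mset_def by (simp add: proots_prod char_poly_ne_0[OF M])
  \<comment> \<open>Block \<open>i * m + j\<close> belongs to the pair of eigenvalues
    \<open>l i\<close>, \<open>l j\<close>.\<close>
  also have "\<dots> = (\<Sum>i<m. \<Sum>j<m. spectrum_mset (M (i * m + j)))"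
    by (rule sum_lessThan_mult_eq)
  also have "\<dots> = (\<Sum>i\<^sub>1 = 0..m - 1. \<Sum>i\<^sub>2 = 0..m - 1.
      (let s = ((\<Sum>i = 0..m - 1. v i * (\<rho> ^ (i * i\<^sub>1) + \<rho> ^ (i * i\<^sub>2))) + a + d) / 2;
           r = csqrt (((\<Sum>i = 1..m - 1. v i * (\<rho> ^ (i * i\<^sub>1) - \<rho> ^ (i * i\<^sub>2))) + a - d)\<^sup>2
                 + 4 * b * c)
       in {# s + 1 / 2 * r, s - 1 / 2 * r #}))"
    unfolding upto
  proof (intro sum.cong refl)
    fix i j assume "i \<in> {..<m}" "j \<in> {..<m}"
    then have Mij: "M (i * m + j) $$ (0, 0) = a + l i" "M (i * m + j) $$ (1, 1) = d + l j"
      "M (i * m + j) $$ (0, 1) = b" "M (i * m + j) $$ (1, 0) = c"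
      using entries by (simp_all add: M_def)
    have plus: "(\<Sum>k<m. v k * (\<rho> ^ (k * i) + \<rho> ^ (k * j))) = l i + l j"
      by (simp add: l_def distrib_left sum.distrib)
    \<comment> \<open>The two sums differ only in the term \<open>k = 0\<close>, which is zero
      because both powers are 1.\<close>
    have "(\<Sum>k = 1..m - 1. v k * (\<rho> ^ (k * i) - \<rho> ^ (k * j))) =
        (\<Sum>k<m. v k * (\<rho> ^ (k * i) - \<rho> ^ (k * j)))"
      using assms(1) by (intro sum.mono_neutral_left) (auto simp: Suc_le_eq)
    also have "\<dots> = l i - l j"
      by (simp add: l_def right_diff_distrib sum_subtractf)
    finally have minus: "(\<Sum>k = 1..m - 1. v k * (\<rho> ^ (k * i) - \<rho> ^ (k * j))) = l i - l j" .
    show "spectrum_mset (M (i * m + j)) =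
      (let s = ((\<Sum>k<m. v k * (\<rho> ^ (k * i) + \<rho> ^ (k * j))) + a + d) / 2;
           r = csqrt (((\<Sum>k = 1..m - 1. v k * (\<rho> ^ (k * i) - \<rho> ^ (k * j))) + a - d)\<^sup>2 + 4 * b * c)
       in {# s + 1 / 2 * r, s - 1 / 2 * r #})"
      unfolding Let_def plus minus
      by (intro spectrum_mset_2_by_2 M, unfold Mij) (simp_all add: algebra_simps)
  qed
  finally show ?thesis .
qed

end
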